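(* Let $V=V(\mathbb{R}^d,\mathbb{R}^k,\Lambda,W)$ be a $d$-dimensional cut-and-project set with a convex $k$-dimensional window $W\subset\mathbb{R}^k$. Then its Helly number satisfies $h(V)\leq 2^{d+k}$.
   Context: Helly number: for a non-empty set $S\subseteq\mathbb{R}^d$, the $S$-Helly number $h(S)$ is the minimal positive integer $n$ with the following property: for every finite family $\mathcal{F}$ of convex sets in $\mathbb{R}^d$ with at least $n$ members, if every $n$ sets from $\mathcal{F}$ have a common point belonging to $S$, then all sets from $\mathcal{F}$ have a common point belonging to $S$. If no such $n$ exists, $h(S)=\infty$. Cut-and-project set: write $\mathbb{R}^{d+k}=\mathbb{R}^d\times\mathbb{R}^k$ and let $\Lambda$ be a (full rank) lattice in $\mathbb{R}^{d+k}$. Let $\pi_1:\mathbb{R}^{d+k}\to\mathbb{R}^d$ and $\pi_2:\mathbb{R}^{d+k}\to\mathbb{R}^k$ be the projections onto the two complementary factors, and assume that $\pi_1|_\Lambda$ is injective and that $\pi_2(\Lambda)$ is dense in $\mathbb{R}^k$. Let $W\subset\mathbb{R}^k$ be a relatively compact set with non-empty interior, called the window. Then $$V(\mathbb{R}^d,\mathbb{R}^k,\Lambda,W)=\{\pi_1(\mathbf{x}) : \mathbf{x}\in\Lambda,\ \pi_2(\mathbf{x})\in W\}\subset\mathbb{R}^d$$ is called a ($d$-dimensional) cut-and-project set with ($k$-dimensional) window $W$. *)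

theory Defs
  imports "HOL-Analysis.Analysis" "HOL-Library.Extended_Nat"
begin

(* A family is a set of sets, so its members are pairwise distinct.  Allowing repetitions would
   give the same number: n members chosen with repetitions can be made to include all the
   distinct ones if there are at most n of these. *)

definition helly_property :: "'a::real_vector set \<Rightarrow> nat \<Rightarrow> bool" where
  "helly_property S n \<longleftrightarrow>
     (\<forall>F. finite F \<and> (\<forall>C\<in>F. convex C) \<and> n \<le> card F \<and>
          (\<forall>G. G \<subseteq> F \<and> card G = n \<longrightarrow> \<Inter>G \<inter> S \<noteq> {})
        \<longrightarrow> \<Inter>F \<inter> S \<noteq> {})"

definition helly_number :: "'a::real_vector set \<Rightarrow> enat" where
  "helly_number S =
     (if \<exists>n>0. helly_property S n then enat (LEAST n. n > 0 \<and> helly_property S n) else \<infinity>)"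

definition full_rank_lattice :: "'a::euclidean_space set \<Rightarrow> bool" where
  "full_rank_lattice \<Lambda> \<longleftrightarrow>
     (\<exists>B. independent B \<and> span B = UNIV \<and>
          \<Lambda> = range (\<lambda>c :: 'a \<Rightarrow> int. \<Sum>b\<in>B. of_int (c b) *\<^sub>R b))"

definition cut_and_project ::
  "((real ^ 'd) \<times> (real ^ 'k)) set \<Rightarrow> (real ^ 'k) set \<Rightarrow> (real ^ 'd) set" where
  "cut_and_project \<Lambda> W = {fst x | x. x \<in> \<Lambda> \<and> snd x \<in> W}"

end

theory Submission
  imports Defs
begin

text \<open>
  The Helly number of a lattice \<open>\<Lambda>\<close> of rank \<open>n\<close> is at most \<open>2 ^ n\<close> (Doignon).  Take convex
  sets \<open>C\<^sub>i\<close> with no common lattice point such that omitting any one of them leaves a family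
  that has one; shrinking them to polytopes makes them bounded.  One after the other, replace
  \<open>C\<^sub>i\<close> by the convex hull of \<open>C\<^sub>i\<close> and \<open>a\<^sub>i\<close> without the point \<open>a\<^sub>i\<close>, where \<open>a\<^sub>i\<close> is a lattice
  point of all the other sets for which this hull has the fewest lattice points: then no
  common lattice point arises.  In the end the midpoint of \<open>a\<^sub>i\<close> and \<open>a\<^sub>j\<close> lies in all the sets,
  so it is not in \<open>\<Lambda>\<close>, and the \<open>a\<^sub>i\<close> lie in different classes modulo \<open>2\<Lambda>\<close>.
  For a cut-and-project set, apply this to the products \<open>C \<times> W\<close>.
\<close>

section \<open>Enlarging the sets of a critical convex family\<close>

lemma extreme_point_of_hull_insert_convex:
  fixes C :: "'a::euclidean_space set"
  assumes "convex C" "a \<notin> C"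
  shows "a extreme_point_of (convex hull (insert a C))"
proof (cases "C = {}")
  case True
  then show ?thesis by (simp add: extreme_point_of_def)
next
  case False
  have hull: "convex hull (insert a C) =
      {(1 - u) *\<^sub>R a + u *\<^sub>R x |x u. 0 \<le> u \<and> u \<le> 1 \<and> x \<in> C}"
    using False \<open>convex C\<close> by (simp add: convex_hull_insert_alt hull_same)
  have False if x: "x \<in> convex hull (insert a C)" and y: "y \<in> convex hull (insert a C)"
    and a: "a \<in> open_segment x y" for x y
  proof -
    obtain u p where u: "0 \<le> u" "u \<le> 1" "p \<in> C" "x = (1 - u) *\<^sub>R a + u *\<^sub>R p"
      using x unfolding hull by blast
    obtain v q where v: "0 \<le> v" "v \<le> 1" "q \<in> C" "y = (1 - v) *\<^sub>R a + v *\<^sub>R q"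
      using y unfolding hull by blast
    obtain t where t: "x \<noteq> y" "0 < t" "t < 1" "a = (1 - t) *\<^sub>R x + t *\<^sub>R y"
      using a by (auto simp: in_segment)
    \<comment> \<open>These are the weights of \<open>p\<close> and \<open>q\<close> after all
      multiples of \<open>a\<close> in \<open>a = (1 - t) *\<^sub>R x + t *\<^sub>R y\<close> are
      moved to one side. They do not both vanish because \<open>x \<noteq> y\<close>, so dividing by
      \<open>s + r\<close> writes \<open>a\<close> as a convex combination of points of
      \<open>C\<close>.\<close>
    define s r where "s = (1 - t) * u" and "r = t * v"
    have "\<not> (u = 0 \<and> v = 0)"
    proof
      assume "u = 0 \<and> v = 0"
      then have "x = y" unfolding u(4) v(4) by simp
      with t(1) show False ..
    qed
    then have pos: "s + r > 0" "s \<ge> 0" "r \<ge> 0"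
      using t(2,3) u(1) v(1) unfolding s_def r_def
      by (auto simp: less_le add_nonneg_eq_0_iff)
    have "(s + r) *\<^sub>R a = s *\<^sub>R p + r *\<^sub>R q"
      using t(4) unfolding u(4) v(4) s_def r_def by (simp add: algebra_simps)
    then have "a = inverse (s + r) *\<^sub>R (s *\<^sub>R p + r *\<^sub>R q)"
      using pos by (metis less_irrefl scaleR_one scaleR_scaleR left_inverse)
    then have "a = (s / (s + r)) *\<^sub>R p + (r / (s + r)) *\<^sub>R q"
      by (simp add: scaleR_add_right divide_inverse mult.commute)
    moreover have "s / (s + r) + r / (s + r) = 1"
      using pos by (simp add: add_divide_distrib[symmetric])
    ultimately have "a \<in> C"
      using convexD[OF \<open>convex C\<close> \<open>p \<in> C\<close> \<open>q \<in> C\<close>, of "s / (s + r)" "r / (s + r)"] pos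
      by simp
    with \<open>a \<notin> C\<close> show False by simp
  qed
  then show ?thesis
    by (auto simp: extreme_point_of_def hull_inc)
qed

text \<open>\<open>D\<close> is the hull of \<open>C\<close> and \<open>a\<close> without its
  extreme point \<open>a\<close>, hence still convex. A point \<open>q\<close> of \<open>P\<close>
  in \<open>D\<close> would give a hull of \<open>C\<close> and \<open>q\<close> inside
  \<open>D\<close>; that hull misses \<open>a\<close>, so it has fewer points of \<open>S\<close>,
  against the choice of \<open>a\<close>. Boundedness keeps these counts finite.\<close>

lemma convex_enlarge_avoiding:
  fixes C :: "'a::euclidean_space set"
  assumes fin: "\<And>X. bounded X \<Longrightarrow> finite (X \<inter> S)"
    and "convex C" "bounded C" "P \<subseteq> S" "P \<noteq> {}" "P \<inter> C = {}"
  obtains a D where "a \<in> P" "convex D" "bounded D" "C \<subseteq> D" "P \<inter> D = {}"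
    "\<And>x. x \<in> D \<Longrightarrow> midpoint a x \<in> D"
proof -
  define H where "H p = convex hull (insert p C)" for p
  obtain a where a: "a \<in> P" and least: "\<And>p. p \<in> P \<Longrightarrow> card (H a \<inter> S) \<le> card (H p \<inter> S)"
    using ex_has_least_nat[of "\<lambda>p. p \<in> P" _ "\<lambda>p. card (H p \<inter> S)"] \<open>P \<noteq> {}\<close> by blast
  have bdd: "bounded (H a)"
    using \<open>bounded C\<close> by (simp add: H_def bounded_convex_hull)
  have aC: "a \<notin> C" using a \<open>P \<inter> C = {}\<close> by blast
  have cH: "convex (H a)" by (simp add: H_def)
  have cD: "convex (H a - {a})"
    using extreme_point_of_hull_insert_convex[OF \<open>convex C\<close> aC]
      extreme_point_of_stillconvex[OF cH] by (simp add: H_def)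
  have CH: "insert a C \<subseteq> H a" by (simp add: H_def hull_subset)
  have disj: "q \<notin> H a - {a}" if "q \<in> P" for q
  proof
    assume q: "q \<in> H a - {a}"
    then have "H q \<subseteq> H a - {a}"
      unfolding H_def[of q] using CH aC cD by (intro hull_minimal) auto
    then have "H q \<inter> S \<subset> H a \<inter> S"
      using CH a \<open>P \<subseteq> S\<close> by blast
    then have "card (H q \<inter> S) < card (H a \<inter> S)"
      using fin[OF bdd] by (simp add: psubset_card_mono)
    with least[OF that] show False by simp
  qed
  have mid: "midpoint a x \<in> H a - {a}" if "x \<in> H a - {a}" for x
  proof -
    have "closed_segment a x \<subseteq> H a"
      using that CH cH by (simp add: closed_segment_subset)
    then show ?thesis using that by (auto simp: midpoint_in_closed_segment midpoint_eq_endpoint)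
  qed
  show thesis
  proof (rule that[of a "H a - {a}"])
    show "bounded (H a - {a})" using bdd by (rule bounded_subset) auto
  qed (use a cD CH aC disj mid in auto)
qed

text \<open>\<open>J\<close> holds the indices already treated. What was achieved for
  \<open>i\<close> in \<open>J\<close> survives the treatment of a new \<open>j\<close>:
  \<open>D i\<close> is not touched again, and \<open>D j\<close> only grows, so it keeps
  \<open>a i\<close>.\<close>

lemma convex_family_enlarge_avoiding:
  fixes C :: "'i \<Rightarrow> 'a::euclidean_space set"
  assumes fin: "\<And>X. bounded X \<Longrightarrow> finite (X \<inter> S)"
    and "\<And>i. i \<in> I \<Longrightarrow> convex (C i)" "\<And>i. i \<in> I \<Longrightarrow> bounded (C i)"
    and "(\<Inter>i\<in>I. C i) \<inter> S = {}"
    and crit: "\<And>i. i \<in> I \<Longrightarrow> (\<Inter>j\<in>I - {i}. C j) \<inter> S \<noteq> {}"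
    and "finite J" "J \<subseteq> I"
  shows "\<exists>D a. (\<forall>i\<in>I. convex (D i) \<and> bounded (D i) \<and> C i \<subseteq> D i) \<and> (\<Inter>i\<in>I. D i) \<inter> S = {} \<and>
      (\<forall>i\<in>J. a i \<in> S \<and> (\<forall>j\<in>I - {i}. a i \<in> D j) \<and> (\<forall>x\<in>D i. midpoint (a i) x \<in> D i))"
  using \<open>finite J\<close> \<open>J \<subseteq> I\<close>
proof (induction J)
  case empty
  show ?case using assms(2-4) by (intro exI[of _ C]) auto
next
  case (insert j J)
  then have "J \<subseteq> I" by simp
  from insert.IH[OF this]
  obtain D a where D: "\<forall>i\<in>I. convex (D i) \<and> bounded (D i) \<and> C i \<subseteq> D i"
      "(\<Inter>i\<in>I. D i) \<inter> S = {}"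
    and a: "\<forall>i\<in>J. a i \<in> S \<and> (\<forall>j\<in>I - {i}. a i \<in> D j) \<and> (\<forall>x\<in>D i. midpoint (a i) x \<in> D i)"
    by (elim exE conjE)
  have "j \<in> I" using insert by simp
  \<comment> \<open>The points of \<open>S\<close> excluded by \<open>D j\<close> alone. Some exist,
    because the sets \<open>D i\<close> contain the \<open>C i\<close> and the original family is
    critical; an enlargement of \<open>D j\<close> that avoids them creates no common point in
    \<open>S\<close>.\<close>
  define P where "P = (\<Inter>i\<in>I - {j}. D i) \<inter> S"
  have "(\<Inter>i\<in>I - {j}. C i) \<subseteq> (\<Inter>i\<in>I - {j}. D i)"
    using D(1) by (intro INT_anti_mono) auto
  then have "P \<noteq> {}" using crit[OF \<open>j \<in> I\<close>] unfolding P_def by blast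
  moreover have "P \<inter> D j = {}" using D(2) \<open>j \<in> I\<close> unfolding P_def by blast
  moreover have "P \<subseteq> S" unfolding P_def by blast
  ultimately obtain b E where E: "b \<in> P" "convex E" "bounded E" "D j \<subseteq> E" "P \<inter> E = {}"
    "\<And>x. x \<in> E \<Longrightarrow> midpoint b x \<in> E"
    using convex_enlarge_avoiding[OF fin, where C = "D j"] D(1) \<open>j \<in> I\<close> by (metis (no_types))
  have "(\<Inter>i\<in>I. (D(j := E)) i) \<inter> S = {}"
    using E(5) \<open>j \<in> I\<close> unfolding P_def by (auto split: if_splits)
  moreover have "b \<in> S" and b: "\<And>k. k \<in> I - {j} \<Longrightarrow> b \<in> D k"
    using E(1) unfolding P_def by auto
  moreover have "convex ((D(j := E)) i) \<and> bounded ((D(j := E)) i) \<and> C i \<subseteq> (D(j := E)) i"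
    if "i \<in> I" for i
    using D(1) that E(2-4) by auto
  moreover have "(a(j := b)) i \<in> S \<and> (\<forall>k\<in>I - {i}. (a(j := b)) i \<in> (D(j := E)) k) \<and>
      (\<forall>x\<in>(D(j := E)) i. midpoint ((a(j := b)) i) x \<in> (D(j := E)) i)"
    if "i \<in> insert j J" for i
  proof (cases "i = j")
    case True
    then show ?thesis using \<open>b \<in> S\<close> b E(6) by simp
  next
    case False
    then have "i \<in> J" using that by simp
    then show ?thesis using False a E(4) by auto
  qed
  ultimately show ?case
    by (intro exI[of _ "D(j := E)"] exI[of _ "a(j := b)"]) blast
qed

lemma critical_family_imp_midpoint_free_points:
  fixes C :: "'i \<Rightarrow> 'a::euclidean_space set"
  assumes fin: "\<And>X. bounded X \<Longrightarrow> finite (X \<inter> S)"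
    and "finite I"
    and conv: "\<And>i. i \<in> I \<Longrightarrow> convex (C i)"
    and empty: "(\<Inter>i\<in>I. C i) \<inter> S = {}"
    and crit: "\<And>i. i \<in> I \<Longrightarrow> (\<Inter>j\<in>I - {i}. C j) \<inter> S \<noteq> {}"
  obtains a where "\<And>i. i \<in> I \<Longrightarrow> a i \<in> S"
    "\<And>i j. i \<in> I \<Longrightarrow> j \<in> I \<Longrightarrow> i \<noteq> j \<Longrightarrow> midpoint (a i) (a j) \<notin> S"
proof -
  have "\<forall>i\<in>I. \<exists>p. p \<in> S \<and> (\<forall>j\<in>I - {i}. p \<in> C j)"
    using crit by fast
  then obtain p where p: "\<And>i. i \<in> I \<Longrightarrow> p i \<in> S" "\<And>i j. i \<in> I \<Longrightarrow> j \<in> I - {i} \<Longrightarrow> p i \<in> C j"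
    by metis
  \<comment> \<open>Bounded replacements for the \<open>C i\<close>: the hull of the finitely many
    witnesses that must lie in \<open>C i\<close>. The same witnesses \<open>p i\<close> show that
    the new family is still critical.\<close>
  define K where "K i = convex hull (p ` (I - {i}))" for i
  have K: "K i \<subseteq> C i" if "i \<in> I" for i
    unfolding K_def using p(2) that conv by (intro hull_minimal) auto
  have pK: "p i \<in> K j" if "i \<in> I" "j \<in> I - {i}" for i j
    unfolding K_def using that by (intro hull_inc) auto
  have "(\<Inter>i\<in>I. K i) \<subseteq> (\<Inter>i\<in>I. C i)" using K by (intro INT_anti_mono) auto
  from Int_mono[OF this order_refl, of S] have "(\<Inter>i\<in>I. K i) \<inter> S = {}"
    unfolding empty by (rule subset_empty[THEN iffD1])
  moreover have "(\<Inter>j\<in>I - {i}. K j) \<inter> S \<noteq> {}" if "i \<in> I" for i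
  proof -
    have "p i \<in> (\<Inter>j\<in>I - {i}. K j) \<inter> S"
      by (intro IntI INT_I p(1)[OF that] pK[OF that])
    then show ?thesis by force
  qed
  moreover have "convex (K i)" "bounded (K i)" for i
    using \<open>finite I\<close> by (simp_all add: K_def finite_imp_bounded_convex_hull)
  ultimately have "\<exists>D a. (\<forall>i\<in>I. convex (D i) \<and> bounded (D i) \<and> K i \<subseteq> D i) \<and> (\<Inter>i\<in>I. D i) \<inter> S = {} \<and>
      (\<forall>i\<in>I. a i \<in> S \<and> (\<forall>j\<in>I - {i}. a i \<in> D j) \<and> (\<forall>x\<in>D i. midpoint (a i) x \<in> D i))"
    by (intro convex_family_enlarge_avoiding[OF fin] \<open>finite I\<close> order_refl)
  then obtain D a where D: "\<forall>i\<in>I. convex (D i) \<and> bounded (D i) \<and> K i \<subseteq> D i"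
      "(\<Inter>i\<in>I. D i) \<inter> S = {}"
    and a: "\<forall>i\<in>I. a i \<in> S \<and> (\<forall>j\<in>I - {i}. a i \<in> D j) \<and> (\<forall>x\<in>D i. midpoint (a i) x \<in> D i)"
    by (elim exE conjE)
  have "midpoint (a i) (a j) \<notin> S" if ij: "i \<in> I" "j \<in> I" "i \<noteq> j" for i j
  proof -
    \<comment> \<open>For \<open>k = i\<close> the point \<open>a j\<close> lies in
      \<open>D i\<close>, which is closed under taking midpoints with \<open>a i\<close>;
      \<open>k = j\<close> is symmetric. Every other \<open>D k\<close> is convex and contains both
      endpoints.\<close>
    have "midpoint (a i) (a j) \<in> D k" if "k \<in> I" for k
    proof (cases "k = i \<or> k = j")
      case True
      then show ?thesis using a ij by (metis DiffI empty_iff insert_iff midpoint_sym)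
    next
      case False
      then have "closed_segment (a i) (a j) \<subseteq> D k"
        using D(1) a ij that by (intro closed_segment_subset) auto
      then show ?thesis by (auto simp: midpoint_in_closed_segment)
    qed
    then show ?thesis using D(2) by blast
  qed
  with a that show thesis by blast
qed

section \<open>Lattices: local finiteness and parity classes\<close>

lemma full_rank_lattice_finite_Int_bounded:
  assumes "full_rank_lattice \<Lambda>" "bounded X"
  shows "finite (X \<inter> \<Lambda>)"
proof -
  obtain B where B: "independent B" "span B = UNIV"
    and \<Lambda>: "\<Lambda> = range (\<lambda>c :: 'a \<Rightarrow> int. \<Sum>b\<in>B. of_int (c b) *\<^sub>R b)"
    using assms(1) unfolding full_rank_lattice_def by blast
  have "finite B" using B(1) by (rule independent_imp_finite)
  \<comment> \<open>Coordinates are linear functionals on a finite-dimensional space, hence bounded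
    on \<open>X\<close>.\<close>
  have "\<forall>b. \<exists>M::int. \<forall>x\<in>X. \<bar>representation B x b\<bar> \<le> of_int M"
  proof
    fix b
    have "linear (\<lambda>x. representation B x b)"
      using linear_representation[OF B] by (simp add: linear_def real_scaleR_def[abs_def])
    then have "bounded ((\<lambda>x. representation B x b) ` X)"
      by (intro bounded_linear_image \<open>bounded X\<close>) (simp add: linear_linear)
    then obtain M where "\<And>x. x \<in> X \<Longrightarrow> \<bar>representation B x b\<bar> \<le> M"
      by (auto simp: bounded_iff)
    then show "\<exists>M::int. \<forall>x\<in>X. \<bar>representation B x b\<bar> \<le> of_int M"
      by (meson order_trans le_of_int_ceiling)
  qed
  then obtain M :: "'a \<Rightarrow> int" where M: "\<And>b x. x \<in> X \<Longrightarrow> \<bar>representation B x b\<bar> \<le> of_int (M b)"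
    by metis
  \<comment> \<open>Coefficient functions are arbitrary outside \<open>B\<close>; restricting them
    to \<open>B\<close> leaves a finite box.\<close>
  have "X \<inter> \<Lambda> \<subseteq> (\<lambda>c. \<Sum>b\<in>B. of_int (c b) *\<^sub>R b) ` (\<Pi>\<^sub>E b\<in>B. {- M b..M b})"
  proof
    fix x assume x: "x \<in> X \<inter> \<Lambda>"
    then obtain c :: "'a \<Rightarrow> int" where c: "x = (\<Sum>b\<in>B. of_int (c b) *\<^sub>R b)"
      using \<Lambda> by blast
    have "representation B x b = of_int (c b)" if "b \<in> B" for b
    proof -
      have "representation B x b = (\<Sum>v\<in>B. of_int (c v) * representation B v b)"
        unfolding c using B by (simp add: representation_sum representation_scale)
      also have "\<dots> = (\<Sum>v\<in>B. if v = b then of_int (c v) else 0)"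
        using B by (intro sum.cong) (auto simp: representation_basis)
      finally show ?thesis using that \<open>finite B\<close> by simp
    qed
    then have "c b \<in> {- M b..M b}" if "b \<in> B" for b
      using M[of x b] x that by (simp add: abs_le_iff)
    then have "restrict c B \<in> (\<Pi>\<^sub>E b\<in>B. {- M b..M b})" by auto
    moreover have "x = (\<Sum>b\<in>B. of_int (restrict c B b) *\<^sub>R b)" unfolding c by simp
    ultimately show "x \<in> (\<lambda>c. \<Sum>b\<in>B. of_int (c b) *\<^sub>R b) ` (\<Pi>\<^sub>E b\<in>B. {- M b..M b})" by blast
  qed
  moreover have "finite (\<Pi>\<^sub>E b\<in>B. {- M b..M b})" using \<open>finite B\<close> by (intro finite_PiE) auto
  ultimately show ?thesis by (meson finite_imageI finite_subset)
qed

text \<open>If the coefficients of two lattice points have the same parities, their midpoint has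
  integer coefficients. So the set of basis vectors with odd coefficient determines
  \<open>i\<close>, and \<open>B\<close> has \<open>2 ^ DIM('a)\<close> subsets.\<close>

lemma full_rank_lattice_midpoint_free_card_le:
  fixes a :: "'i \<Rightarrow> 'a::euclidean_space"
  assumes "full_rank_lattice \<Lambda>"
    and a: "\<And>i. i \<in> I \<Longrightarrow> a i \<in> \<Lambda>"
    and mid: "\<And>i j. i \<in> I \<Longrightarrow> j \<in> I \<Longrightarrow> i \<noteq> j \<Longrightarrow> midpoint (a i) (a j) \<notin> \<Lambda>"
  shows "card I \<le> 2 ^ DIM('a)"
proof -
  obtain B where B: "independent B" "span B = UNIV"
    and \<Lambda>: "\<Lambda> = range (\<lambda>c :: 'a \<Rightarrow> int. \<Sum>b\<in>B. of_int (c b) *\<^sub>R b)"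
    using assms(1) unfolding full_rank_lattice_def by blast
  have "finite B" using B(1) by (rule independent_imp_finite)
  have "card B = DIM('a)"
    using basis_card_eq_dim[of B UNIV] B by simp
  obtain c :: "'i \<Rightarrow> 'a \<Rightarrow> int" where c: "\<And>i. i \<in> I \<Longrightarrow> a i = (\<Sum>b\<in>B. of_int (c i b) *\<^sub>R b)"
    using a unfolding \<Lambda> image_iff by metis
  have "inj_on (\<lambda>i. {b\<in>B. odd (c i b)}) I"
  proof (rule inj_onI, rule ccontr)
    fix i j assume ij: "i \<in> I" "j \<in> I" "i \<noteq> j" and eq: "{b\<in>B. odd (c i b)} = {b\<in>B. odd (c j b)}"
    have "of_int (c i b) + of_int (c j b) = 2 * real_of_int ((c i b + c j b) div 2)" if "b \<in> B" for b
    proof -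
      have "even (c i b + c j b)" using eq that by auto
      then have "c i b + c j b = 2 * ((c i b + c j b) div 2)" by simp
      then show ?thesis by (metis of_int_add of_int_mult of_int_numeral)
    qed
    then have "(\<Sum>b\<in>B. (of_int (c i b) + of_int (c j b)) *\<^sub>R b) =
        (\<Sum>b\<in>B. (2 * real_of_int ((c i b + c j b) div 2)) *\<^sub>R b)"
      by (intro sum.cong) auto
    then have "a i + a j = 2 *\<^sub>R (\<Sum>b\<in>B. real_of_int ((c i b + c j b) div 2) *\<^sub>R b)"
      using ij by (simp add: c scaleR_add_left sum.distrib scaleR_sum_right)
    then have "midpoint (a i) (a j) = (\<Sum>b\<in>B. real_of_int ((c i b + c j b) div 2) *\<^sub>R b)"
      by (simp add: midpoint_def)
    then have "midpoint (a i) (a j) \<in> \<Lambda>" unfolding \<Lambda>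
      by (intro image_eqI[where x = "\<lambda>b. (c i b + c j b) div 2"]) auto
    with mid[OF ij] show False by blast
  qed
  then have "card I \<le> card (Pow B)"
    using \<open>finite B\<close> by (intro card_inj_on_le[where f = "\<lambda>i. {b\<in>B. odd (c i b)}"]) auto
  then show ?thesis
    using \<open>finite B\<close> \<open>card B = DIM('a)\<close> by (simp add: card_Pow)
qed

section \<open>Doignon's theorem for lattices\<close>

theorem doignon_helly_property:
  fixes \<Lambda> :: "'a::euclidean_space set"
  assumes "full_rank_lattice \<Lambda>"
  shows "helly_property \<Lambda> (2 ^ DIM('a))"
  unfolding helly_property_def
proof (intro allI impI, elim conjE, rule ccontr)
  fix F :: "'a set set"
  assume F: "finite F" "\<forall>C\<in>F. convex C" "2 ^ DIM('a) \<le> card F"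
    "\<forall>G. G \<subseteq> F \<and> card G = 2 ^ DIM('a) \<longrightarrow> \<Inter>G \<inter> \<Lambda> \<noteq> {}"
    and "\<not> \<Inter>F \<inter> \<Lambda> \<noteq> {}"
  \<comment> \<open>An inclusion-minimal member of \<open>\<G>\<close> is a critical family:
    dropping any of its sets yields a common lattice point.\<close>
  define \<G> where "\<G> = {G. G \<subseteq> F \<and> \<Inter>G \<inter> \<Lambda> = {}}"
  have "finite \<G>" unfolding \<G>_def using F(1) by simp
  moreover have "F \<in> \<G>" unfolding \<G>_def using \<open>\<not> \<Inter>F \<inter> \<Lambda> \<noteq> {}\<close> by simp
  ultimately obtain G where "G \<in> \<G>" and min: "\<And>H. H \<in> \<G> \<Longrightarrow> H \<subseteq> G \<Longrightarrow> G = H"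
    using finite_has_minimal2[of \<G> F] by metis
  then have G: "G \<subseteq> F" "\<Inter>G \<inter> \<Lambda> = {}" unfolding \<G>_def by simp_all
  have "finite G" using G(1) F(1) by (rule finite_subset)
  have crit: "(\<Inter>D\<in>G - {C}. D) \<inter> \<Lambda> \<noteq> {}" if "C \<in> G" for C
  proof
    assume "(\<Inter>D\<in>G - {C}. D) \<inter> \<Lambda> = {}"
    then have "G - {C} \<in> \<G>" using G(1) unfolding \<G>_def by auto
    then have "G = G - {C}" using min by blast
    with that show False by blast
  qed
  have empty: "(\<Inter>C\<in>G. C) \<inter> \<Lambda> = {}" using G(2) by simp
  have conv: "\<And>C. C \<in> G \<Longrightarrow> convex C" using F(2) G(1) by blast
  obtain a where "\<And>C. C \<in> G \<Longrightarrow> a C \<in> \<Lambda>"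
    "\<And>C D. C \<in> G \<Longrightarrow> D \<in> G \<Longrightarrow> C \<noteq> D \<Longrightarrow> midpoint (a C) (a D) \<notin> \<Lambda>"
    using critical_family_imp_midpoint_free_points
      [OF full_rank_lattice_finite_Int_bounded[OF assms] \<open>finite G\<close> conv empty crit] by blast
  then have "card G \<le> 2 ^ DIM('a)"
    by (rule full_rank_lattice_midpoint_free_card_le[OF assms])
  \<comment> \<open>Padding \<open>G\<close> with members of \<open>F\<close> to exactly
    \<open>2 ^ DIM('a)\<close> sets makes the hypothesis on \<open>F\<close> applicable, while the
    intersection only shrinks.\<close>
  then obtain H where H: "G \<subseteq> H" "H \<subseteq> F" "card H = 2 ^ DIM('a)"
    using exists_subset_between[of G "2 ^ DIM('a)" F] F(1,3) G(1) by blast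
  then have "\<Inter>H \<inter> \<Lambda> \<noteq> {}" using F(4) by blast
  with G(2) H(1) show False by blast
qed

section \<open>Transfer from the lattice to the cut-and-project set\<close>

lemma helly_property_cut_and_project:
  fixes \<Lambda> :: "((real ^ 'd) \<times> (real ^ 'k)) set"
  assumes "helly_property \<Lambda> n" "n > 0" "convex W" "W \<noteq> {}"
  shows "helly_property (cut_and_project \<Lambda> W) n"
  unfolding helly_property_def
proof (intro allI impI, elim conjE)
  fix F :: "(real ^ 'd) set set"
  assume F: "finite F" "\<forall>C\<in>F. convex C" "n \<le> card F"
    "\<forall>G. G \<subseteq> F \<and> card G = n \<longrightarrow> \<Inter>G \<inter> cut_and_project \<Lambda> W \<noteq> {}"
  define e where "e = (\<lambda>C :: (real ^ 'd) set. C \<times> W)"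
  \<comment> \<open>A non-empty \<open>W\<close> lets \<open>C\<close> be recovered from
    \<open>C \<times> W\<close>, so subfamilies keep their cardinality.\<close>
  have inj: "inj_on e X" for X
    using \<open>W \<noteq> {}\<close> by (simp add: inj_on_def e_def times_eq_iff)
  \<comment> \<open>The empty family is excluded since its intersection is the whole space and not a
    product with \<open>W\<close>; \<open>n > 0\<close> rules it out below.\<close>
  have iff: "\<Inter>(e ` G) \<inter> \<Lambda> \<noteq> {} \<longleftrightarrow> \<Inter>G \<inter> cut_and_project \<Lambda> W \<noteq> {}" if "G \<noteq> {}" for G
  proof -
    have "\<Inter>(e ` G) = \<Inter>G \<times> W" using that by (auto simp: e_def)
    then show ?thesis by (fastforce simp: cut_and_project_def)
  qed
  have "\<Inter>H \<inter> \<Lambda> \<noteq> {}" if H: "H \<subseteq> e ` F" "card H = n" for H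
  proof -
    obtain G where G: "G \<subseteq> F" "H = e ` G" using H(1) by (auto simp: subset_image_iff)
    then have "card G = n" using H(2) inj by (simp add: card_image)
    then have "\<Inter>G \<inter> cut_and_project \<Lambda> W \<noteq> {}" using F(4) G(1) by blast
    moreover have "G \<noteq> {}" using \<open>card G = n\<close> \<open>n > 0\<close> by auto
    ultimately show ?thesis using iff unfolding G(2) by blast
  qed
  moreover have "n \<le> card (e ` F)" using F(3) inj by (simp add: card_image)
  moreover have "\<forall>C\<in>e ` F. convex C" using F(2) \<open>convex W\<close> by (auto simp: e_def convex_Times)
  ultimately have "\<Inter>(e ` F) \<inter> \<Lambda> \<noteq> {}"
    using \<open>helly_property \<Lambda> n\<close>[unfolded helly_property_def, THEN spec, of "e ` F"] F(1) by simp
  moreover have "F \<noteq> {}" using F(3) \<open>n > 0\<close> by auto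
  ultimately show "\<Inter>F \<inter> cut_and_project \<Lambda> W \<noteq> {}" using iff by blast
qed

lemma helly_number_le:
  assumes "helly_property S n" "n > 0"
  shows "helly_number S \<le> enat n"
  using assms by (auto simp: helly_number_def intro: Least_le)

theorem theorem3p5:
  fixes \<Lambda> :: "((real ^ 'd) \<times> (real ^ 'k)) set"
    and W :: "(real ^ 'k) set"
  assumes "full_rank_lattice \<Lambda>"
    and "inj_on fst \<Lambda>"
    and "closure (snd ` \<Lambda>) = UNIV"
    and "compact (closure W)"
    and "interior W \<noteq> {}"
    and "convex W"
  shows "helly_number (cut_and_project \<Lambda> W) \<le> enat (2 ^ (CARD('d) + CARD('k)))"
proof (intro helly_number_le helly_property_cut_and_project)
  show "helly_property \<Lambda> (2 ^ (CARD('d) + CARD('k)))"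
    using doignon_helly_property[OF assms(1)] by simp
  show "W \<noteq> {}" using assms(5) by auto
qed (use assms(6) in auto)

end
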